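(* Let $g(x)$ be a symmetric polynomial of degree $n\ge 1$ with complex coefficients, let $g_{\delta}(x)=\frac{n}{2}g(x)-xg'(x)$, and let $z\in\mathbb{C}$ with $\Re z>0$. Then the number of roots of the polynomial $$f(x)=g_{\delta}(x)-z\,g(x)$$ outside the circle $|x|=1$ (that is, with $|x|>1$) equals the number of roots of $g(x)$ inside this circle, equivalently the number of roots of $g(x)$ outside this circle, all roots being counted with multiplicity.
   Context: A polynomial $g(x)=a_0+a_1x+\dots+a_nx^n$ of degree $n$ with complex coefficients is called symmetric if $g(x)=x^n\overline{g}(1/x)$, where $\overline{g}$ denotes the polynomial whose coefficients are the complex conjugates of those of $g$; i.e. $a_k=\overline{a}_{n-k}$ for all $k$ (in particular $a_0=\overline{a}_n\neq0$). The non-unimodular roots of such a polynomial occur in pairs $\beta$, $1/\overline{\beta}$ of equal multiplicity, so it has as many roots inside the unit circle as outside. *)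

theory Defs
  imports Complex_Main "HOL-Computational_Algebra.Polynomial"
begin

definition symmetric_poly :: "complex poly \<Rightarrow> bool" where
  "symmetric_poly g \<longleftrightarrow>
     (\<forall>x. x \<noteq> 0 \<longrightarrow> poly g x = x ^ degree g * poly (map_poly cnj g) (1 / x))"

definition g_delta :: "complex poly \<Rightarrow> complex poly" where
  "g_delta g = smult (of_nat (degree g) / 2) g - [:0, 1:] * pderiv g"

lemma symmetric_poly_iff_reflect:
  "symmetric_poly g \<longleftrightarrow> g = reflect_poly (map_poly cnj g)"
proof -
  have deg: "degree (map_poly cnj g) = degree g"
    by (rule degree_map_poly) auto
  have ev: "poly (reflect_poly (map_poly cnj g)) x
      = x ^ degree g * poly (map_poly cnj g) (1 / x)" if "x \<noteq> 0" for x
    using poly_reflect_poly_nz[of x "map_poly cnj g"] that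
    by (simp add: deg inverse_eq_divide)
  show ?thesis
  proof
    assume sym: "symmetric_poly g"
    let ?d = "g - reflect_poly (map_poly cnj g)"
    have "poly ?d x = 0" if "x \<noteq> 0" for x
      using sym[unfolded symmetric_poly_def, rule_format, OF that] ev[OF that]
      unfolding poly_diff by (metis right_minus_eq)
    then have "UNIV - {0} \<subseteq> {x. poly ?d x = 0}"
      by blast
    moreover have "infinite (UNIV - {0::complex})"
      by (simp add: infinite_UNIV_char_0)
    ultimately have "infinite {x. poly ?d x = 0}"
      using infinite_super by blast
    then show "g = reflect_poly (map_poly cnj g)"
      using poly_roots_finite[of ?d] by (metis right_minus_eq)
  next
    assume "g = reflect_poly (map_poly cnj g)"
    then show "symmetric_poly g"
      unfolding symmetric_poly_def using ev by metis
  qed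
qed

lemma symmetric_poly_iff_coeff:
  "symmetric_poly g \<longleftrightarrow> (\<forall>k\<le>degree g. coeff g k = cnj (coeff g (degree g - k)))"
proof -
  have "degree (map_poly cnj g) = degree g"
    by (rule degree_map_poly) auto
  then have co: "coeff (reflect_poly (map_poly cnj g)) k
      = (if k > degree g then 0 else cnj (coeff g (degree g - k)))" for k
    by (simp add: coeff_reflect_poly coeff_map_poly)
  have "symmetric_poly g \<longleftrightarrow>
      (\<forall>k. coeff g k = coeff (reflect_poly (map_poly cnj g)) k)"
    unfolding symmetric_poly_iff_reflect by (rule poly_eq_iff)
  also have "\<dots> \<longleftrightarrow>
      (\<forall>k\<le>degree g. coeff g k = cnj (coeff g (degree g - k)))"
    unfolding co using coeff_eq_0[of g] by (metis not_less)
  finally show ?thesis .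
qed

end

theory Submission
  imports
    Defs
    "HOL-Computational_Algebra.Fundamental_Theorem_Algebra"
    "HOL-Complex_Analysis.Complex_Analysis"
begin

text \<open>
  Write \<open>w = g_delta g / g\<close>, so that \<open>f = g (w - z)\<close>. Summing \<open>1/2 - x/(x - r)\<close> over the roots
  \<open>r\<close> of \<open>g\<close> gives \<open>Re w(x) = - (\<Sum>r. (|x|^2 - |r|^2) / (2 |x - r|^2))\<close>. For \<open>|x| = 1\<close> each term
  changes sign under \<open>r \<mapsto> 1/cnj r\<close>, which permutes the roots of a symmetric polynomial, so the sum
  vanishes on the unit circle. Slightly outside the circle the non-unimodular roots contribute little
  by continuity, while the unimodular ones make \<open>Re w\<close> only smaller; hence \<open>Re (f/g) < 0\<close> on
  some annulus \<open>1 < |x| < 1 + e\<close>. There \<open>f'/f - g'/g\<close> has the primitive \<open>Ln (-f/g)\<close>, so by the argument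
  principle \<open>f\<close> and \<open>g\<close>, which have the same degree, have equally many roots outside.
\<close>

section \<open>Logarithmic derivatives and root counting by contour integrals\<close>

lemma poly_log_deriv_eq_sum_proots:
  fixes p :: "complex poly"
  assumes "poly p x \<noteq> 0"
  shows "poly (pderiv p) x / poly p x = (\<Sum>r\<in>#proots p. 1 / (x - r))"
proof -
  have *: "poly (pderiv (\<Prod>r\<in>#M. [:-r, 1:])) x =
      poly (\<Prod>r\<in>#M. [:-r, 1:]) x * (\<Sum>r\<in>#M. 1 / (x - r))" if "x \<notin># M" for M
    using that
  proof (induction M)
    case (add r M)
    let ?P = "\<Prod>r\<in>#M. [:-r, 1:]"
    have "x - r \<noteq> 0" using add.prems by auto
    have "pderiv ([:-r, 1:] * ?P) = ?P + [:-r, 1:] * pderiv ?P"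
      by (subst pderiv_mult) (simp add: pderiv_pCons)
    then have "poly (pderiv ([:-r, 1:] * ?P)) x = poly ?P x + poly [:-r, 1:] x * poly (pderiv ?P) x"
      by (simp only: poly_add poly_mult)
    also have "poly (pderiv ?P) x = poly ?P x * (\<Sum>r\<in>#M. 1 / (x - r))"
      using add by auto
    also have "poly ?P x + poly [:-r, 1:] x * \<dots> =
        (x - r) * poly ?P x * (1 / (x - r) + (\<Sum>r\<in>#M. 1 / (x - r)))"
      using \<open>x - r \<noteq> 0\<close> by (simp add: field_simps)
    also have "\<dots> = poly ([:-r, 1:] * ?P) x * (\<Sum>r\<in>#add_mset r M. 1 / (x - r))"
      by (simp only: poly_mult) simp
    finally show ?case by simp
  qed auto
  define P where "P = (\<Prod>r\<in>#proots p. [:-r, 1:])"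
  have p: "p = smult (lead_coeff p) P"
    unfolding P_def by (rule complex_poly_decompose_multiset[symmetric])
  have "p \<noteq> 0" using assms by auto
  then have "x \<notin># proots p" using assms by simp
  from *[OF this] have "poly (pderiv P) x = poly P x * (\<Sum>r\<in>#proots p. 1 / (x - r))"
    unfolding P_def .
  moreover have "poly (pderiv p) x = lead_coeff p * poly (pderiv P) x" "poly p x = lead_coeff p * poly P x"
    using arg_cong[OF p, of "\<lambda>q. poly (pderiv q) x"] arg_cong[OF p, of "\<lambda>q. poly q x"]
    by (simp_all only: pderiv_smult poly_smult)
  ultimately show ?thesis using assms by simp
qed

text \<open>The argument principle for polynomials: after the expansion into simple fractions, each
  root contributes its winding number, 1 inside the circle and 0 outside, and \<open>proots\<close>
  accounts for multiplicity.\<close>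

lemma has_contour_integral_poly_log_deriv:
  fixes p :: "complex poly"
  assumes "0 < \<rho>" and nz: "\<And>x. norm x = \<rho> \<Longrightarrow> poly p x \<noteq> 0"
  shows "((\<lambda>x. poly (pderiv p) x / poly p x) has_contour_integral
    2 * pi * \<i> * of_nat (size {# r \<in># proots p. norm r < \<rho> #})) (circlepath 0 \<rho>)"
proof -
  have *: "((\<lambda>x. \<Sum>r\<in>#M. 1 / (x - r)) has_contour_integral
    2 * pi * \<i> * of_nat (size {# r \<in># M. norm r < \<rho> #})) (circlepath 0 \<rho>)"
    if "\<And>r. r \<in># M \<Longrightarrow> norm r \<noteq> \<rho>" for M
    using that
  proof (induction M)
    case (add r M)
    have "norm r \<noteq> \<rho>" using add.prems by simp
    then have "((\<lambda>x. 1 / (x - r)) has_contour_integral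
        2 * pi * \<i> * winding_number (circlepath 0 \<rho>) r) (circlepath 0 \<rho>)"
      using \<open>0 < \<rho>\<close> by (intro has_contour_integral_winding_number) auto
    moreover have "winding_number (circlepath 0 \<rho>) r = (if norm r < \<rho> then 1 else 0)"
    proof (cases "norm r < \<rho>")
      case True
      then show ?thesis by (simp add: winding_number_circlepath)
    next
      case False
      then have "winding_number (circlepath 0 \<rho>) r = 0"
        using \<open>norm r \<noteq> \<rho>\<close> \<open>0 < \<rho>\<close>
        by (intro winding_number_zero_outside[of _ "cball 0 \<rho>"]) auto
      then show ?thesis using False by simp
    qed
    ultimately have "((\<lambda>x. 1 / (x - r)) has_contour_integral
        2 * pi * \<i> * (if norm r < \<rho> then 1 else 0)) (circlepath 0 \<rho>)" by simp
    from has_contour_integral_add[OF this add.IH] add.prems show ?case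
      by (auto simp: algebra_simps split: if_splits)
  qed (auto simp: has_contour_integral_0)
  have "p \<noteq> 0" using nz[of "of_real \<rho>"] \<open>0 < \<rho>\<close> by auto
  then have "\<And>r. r \<in># proots p \<Longrightarrow> norm r \<noteq> \<rho>" using nz by auto
  from *[OF this] show ?thesis
    by (rule has_contour_integral_eq)
       (use \<open>0 < \<rho>\<close> in \<open>auto simp: poly_log_deriv_eq_sum_proots nz\<close>)
qed

lemma size_proots_inside_eq:
  fixes p q :: "complex poly"
  assumes "0 < \<rho>"
    and neg: "\<And>x. norm x = \<rho> \<Longrightarrow> Re (poly p x / poly q x) < 0"
  shows "size {# r \<in># proots p. norm r < \<rho> #} = size {# r \<in># proots q. norm r < \<rho> #}"
proof -
  let ?L = "\<lambda>x. Ln (- (poly p x / poly q x))"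
  \<comment> \<open>Division by zero gives 0, so a strictly negative real part excludes zeros of
    both polynomials.\<close>
  have nz: "poly p x \<noteq> 0" "poly q x \<noteq> 0" if "norm x = \<rho>" for x
    using neg[OF that] by auto
  have "(?L has_field_derivative
      (poly (pderiv p) x / poly p x - poly (pderiv q) x / poly q x)) (at x within sphere 0 \<rho>)"
    if "x \<in> sphere 0 \<rho>" for x
  proof -
    have x: "norm x = \<rho>" using that by simp
    note nzx = nz[OF x]
    \<comment> \<open>The negated quotient lies in the right half-plane, away from the branch cut of
      \<open>Ln\<close>.\<close>
    have "- (poly p x / poly q x) \<notin> \<real>\<^sub>\<le>\<^sub>0"
      using neg[OF x] by (auto simp: complex_nonpos_Reals_iff)
    note L = has_field_derivative_Ln[OF this]
    have "((\<lambda>x. - (poly p x / poly q x)) has_field_derivative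
        - ((poly (pderiv p) x * poly q x - poly p x * poly (pderiv q) x) / (poly q x * poly q x)))
        (at x within sphere 0 \<rho>)"
      by (intro DERIV_minus DERIV_divide has_field_derivative_at_within[OF poly_DERIV] nzx)
    from DERIV_chain2[OF L this] show ?thesis
      by (rule DERIV_cong) (use nzx in \<open>simp add: field_simps\<close>)
  qed
  from Cauchy_theorem_primitive[OF this]
  have "((\<lambda>x. poly (pderiv p) x / poly p x - poly (pderiv q) x / poly q x)
      has_contour_integral 0) (circlepath 0 \<rho>)"
    using \<open>0 < \<rho>\<close> by simp
  moreover have "((\<lambda>x. poly (pderiv p) x / poly p x - poly (pderiv q) x / poly q x)
      has_contour_integral
        (2 * pi * \<i> * of_nat (size {# r \<in># proots p. norm r < \<rho> #}) -
         2 * pi * \<i> * of_nat (size {# r \<in># proots q. norm r < \<rho> #}))) (circlepath 0 \<rho>)"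
    by (intro has_contour_integral_diff has_contour_integral_poly_log_deriv nz assms(1))
  ultimately show ?thesis
    by (auto dest: has_contour_integral_unique)
qed

section \<open>Inversion in the unit circle acting on the roots\<close>

lemma map_poly_cnj_mult: "map_poly cnj (p * q) = map_poly cnj p * map_poly cnj q"
  by (simp add: poly_eq_poly_eq_iff[symmetric] fun_eq_iff)

text \<open>Conjugate reversal is multiplicative and turns the factor \<open>x - r\<close> into
  \<open>1 - cnj r * x\<close>, whose root is \<open>inverse (cnj r)\<close>. This requires
  \<open>r \<noteq> 0\<close>, hence the condition at 0.\<close>

lemma proots_reflect_poly_cnj:
  assumes "poly p 0 \<noteq> 0"
  shows "proots (reflect_poly (map_poly cnj p)) = image_mset (\<lambda>r. inverse (cnj r)) (proots p)"
proof -
  have *: "proots (reflect_poly (map_poly cnj (\<Prod>r\<in>#M. [:-r, 1:]))) =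
      image_mset (\<lambda>r. inverse (cnj r)) M"
    if "0 \<notin># M" for M
    using that
  proof (induction M)
    case (add r M)
    let ?P = "\<Prod>r\<in>#M. [:-r, 1:]"
    have "r \<noteq> 0" using add.prems by auto
    then have lin: "reflect_poly (map_poly cnj [:-r, 1:]) = smult (- cnj r) [:- inverse (cnj r), 1:]"
      by (simp add: reflect_poly_pCons map_poly_pCons)
    have "?P \<noteq> 0" by (auto simp: prod_mset_zero_iff)
    then have "reflect_poly (map_poly cnj ?P) \<noteq> 0"
      by (simp add: map_poly_eq_0_iff)
    then have "proots (reflect_poly (map_poly cnj ([:-r, 1:] * ?P))) =
        proots (reflect_poly (map_poly cnj [:-r, 1:])) + proots (reflect_poly (map_poly cnj ?P))"
      unfolding map_poly_cnj_mult reflect_poly_mult lin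
      by (intro proots_mult) (use \<open>r \<noteq> 0\<close> in auto)
    also have "\<dots> = {#inverse (cnj r)#} + image_mset (\<lambda>r. inverse (cnj r)) M"
    proof -
      have "proots (smult (- cnj r) [:- inverse (cnj r), 1:]) = {#inverse (cnj r)#}"
        using \<open>r \<noteq> 0\<close> by (subst proots_smult) (simp_all only: proots_linear_factor, simp_all)
      moreover have "proots (reflect_poly (map_poly cnj ?P)) = image_mset (\<lambda>r. inverse (cnj r)) M"
        by (rule add.IH) (use add.prems in simp)
      ultimately show ?thesis by (simp only: lin)
    qed
    also have "\<dots> = image_mset (\<lambda>r. inverse (cnj r)) (add_mset r M)"
      by simp
    finally show ?case by (simp only: image_mset_add_mset prod_mset.add_mset)
  qed auto
  have "p \<noteq> 0" using assms by auto
  then have "0 \<notin># proots p" using assms by simp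
  define P where "P = (\<Prod>r\<in>#proots p. [:-r, 1:])"
  have p: "p = smult (lead_coeff p) P"
    unfolding P_def by (rule complex_poly_decompose_multiset[symmetric])
  have "reflect_poly (map_poly cnj p) = smult (cnj (lead_coeff p)) (reflect_poly (map_poly cnj P))"
    using arg_cong[OF p, of "\<lambda>q. reflect_poly (map_poly cnj q)"]
    by (simp only: map_poly_smult[where f = cnj, OF complex_cnj_zero complex_cnj_mult] reflect_poly_smult)
  then have "proots (reflect_poly (map_poly cnj p)) = proots (reflect_poly (map_poly cnj P))"
    using \<open>p \<noteq> 0\<close> by (simp only: proots_smult complex_cnj_zero_iff leading_coeff_0_iff not_False_eq_True)
  with *[OF \<open>0 \<notin># proots p\<close>] show ?thesis
    unfolding P_def by (rule trans[rotated])
qed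

lemma symmetric_poly_0_nonroot:
  assumes "symmetric_poly g" "g \<noteq> 0"
  shows "poly g 0 \<noteq> 0"
proof -
  have "coeff g 0 = cnj (lead_coeff g)"
    using assms(1)[unfolded symmetric_poly_iff_coeff, rule_format, of 0] by simp
  then show ?thesis using assms(2) by (simp add: poly_0_coeff_0)
qed

lemma symmetric_poly_proots_invariant:
  assumes "symmetric_poly g"
  shows "image_mset (\<lambda>r. inverse (cnj r)) (proots g) = proots g"
proof (cases "g = 0")
  case False
  from proots_reflect_poly_cnj[OF symmetric_poly_0_nonroot[OF assms False]] show ?thesis
    by (simp only: symmetric_poly_iff_reflect[THEN iffD1, OF assms, symmetric])
qed auto

text \<open>Inversion in the circle permutes the root multiset and exchanges the inside with the
  outside.\<close>

lemma symmetric_poly_size_inside_eq_outside: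
  assumes "symmetric_poly g" "g \<noteq> 0"
  shows "size {# r \<in># proots g. norm r < 1 #} = size {# r \<in># proots g. norm r > 1 #}"
proof -
  have nz: "r \<noteq> 0" if "r \<in># proots g" for r
    using that symmetric_poly_0_nonroot[OF assms(1,2)] assms(2) by auto
  have "{# r \<in># proots g. norm r < 1 #} =
      {# r \<in># image_mset (\<lambda>r. inverse (cnj r)) (proots g). norm r < 1 #}"
    by (simp add: symmetric_poly_proots_invariant[OF assms(1)])
  also have "\<dots> = image_mset (\<lambda>r. inverse (cnj r)) {# r \<in># proots g. norm (inverse (cnj r)) < 1 #}"
    by (simp add: filter_mset_image_mset)
  also have "{# r \<in># proots g. norm (inverse (cnj r)) < 1 #} = {# r \<in># proots g. norm r > 1 #}"
    by (rule filter_mset_cong) (use nz in \<open>auto simp: norm_divide field_simps\<close>)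
  finally show ?thesis by simp
qed

section \<open>The real part of \<open>g_delta g / g\<close> as a sum of Poisson kernels\<close>

text \<open>For \<open>norm r < norm x\<close> this is half the Poisson kernel at \<open>r\<close>
  of the disc of radius \<open>norm x\<close>, up to normalisation. At \<open>x = r\<close> it takes
  the value 0.\<close>

definition poisson_term :: "complex \<Rightarrow> complex \<Rightarrow> real" where
  "poisson_term x r = ((norm x)\<^sup>2 - (norm r)\<^sup>2) / (2 * (norm (x - r))\<^sup>2)"

text \<open>The left side is the real part of \<open>(x + r) / (2 * (x - r))\<close>; multiplying
  numerator and denominator by \<open>cnj (x - r)\<close> yields the kernel.\<close>

lemma Re_eq_poisson_term:
  fixes x r :: complex
  assumes "x \<noteq> r"
  shows "Re (x / (x - r)) - 1 / 2 = poisson_term x r"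
proof -
  have "(norm (x - r))\<^sup>2 \<noteq> 0" using assms by simp
  then show ?thesis unfolding poisson_term_def
    by (simp add: Re_divide cmod_power2 field_simps) (simp add: power2_eq_square algebra_simps)
qed

text \<open>On the unit circle, inverting \<open>r\<close> divides the distance to \<open>x\<close>
  by \<open>norm r\<close>, while \<open>1 - (norm r)\<^sup>2\<close> is negated and divided by
  \<open>(norm r)\<^sup>2\<close>; the scalings cancel and the sign remains.\<close>

lemma poisson_term_reflect:
  assumes "norm x = 1" "r \<noteq> 0"
  shows "poisson_term x (inverse (cnj r)) = - poisson_term x r"
proof -
  have "x * cnj x = 1" using assms(1) by (simp add: complex_norm_square[symmetric])
  then have "x - inverse (cnj r) = - x / cnj r * cnj (x - r)"
    using assms(2) by (simp add: field_simps)
  then have "norm (x - inverse (cnj r)) = norm (x - r) / norm r"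
    using assms by (simp add: norm_mult norm_divide del: complex_cnj_diff)
  then show ?thesis
    unfolding poisson_term_def using assms
    by (simp only: norm_inverse complex_mod_cnj) (cases "x = r"; simp add: field_simps)
qed

text \<open>The constant \<open>degree g / 2\<close> in \<open>g_delta\<close> supplies exactly one
  summand 1/2 per root, since over the complex numbers there are \<open>degree g\<close> of
  them.\<close>

lemma Re_g_delta_quotient:
  fixes g :: "complex poly"
  assumes "poly g x \<noteq> 0"
  shows "Re (poly (g_delta g) x / poly g x) = - (\<Sum>r\<in>#proots g. poisson_term x r)"
proof -
  have *: "Re (x * (\<Sum>r\<in>#M. 1 / (x - r))) - size M / 2 = (\<Sum>r\<in>#M. poisson_term x r)"
    if "x \<notin># M" for M
    using that
  proof (induction M)
    case (add r M)
    have "x \<noteq> r" using add.prems by auto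
    from Re_eq_poisson_term[OF this] add show ?case
      by (simp add: distrib_left add_divide_distrib)
  qed auto
  have "g \<noteq> 0" using assms by auto
  then have "x \<notin># proots g" using assms by simp
  have "poly (g_delta g) x / poly g x = of_nat (degree g) / 2 - x * (poly (pderiv g) x / poly g x)"
    using assms by (simp add: g_delta_def field_simps)
  also have "\<dots> = of_nat (size (proots g)) / 2 - x * (\<Sum>r\<in>#proots g. 1 / (x - r))"
    by (simp only: poly_log_deriv_eq_sum_proots[OF assms] size_proots_complex)
  finally show ?thesis
    using *[OF \<open>x \<notin># proots g\<close>] by simp
qed

lemma continuous_on_poisson_sum:
  assumes "\<And>r. r \<in># M \<Longrightarrow> r \<notin> S"
  shows "continuous_on S (\<lambda>x. \<Sum>r\<in>#M. poisson_term x r)"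
  using assms
proof (induction M)
  case (add r M)
  have "continuous_on S (\<lambda>x. poisson_term x r)"
    unfolding poisson_term_def using add.prems by (intro continuous_intros) auto
  with add show ?case by (auto intro: continuous_on_add)
qed auto

text \<open>Reindexing by the inversion shows that the sum equals its own negative. The point
  \<open>x\<close> may itself be a root, as such terms are 0.\<close>

lemma poisson_sum_symmetric_eq_0:
  assumes "symmetric_poly g" "g \<noteq> 0" "norm x = 1"
  shows "(\<Sum>r\<in>#proots g. poisson_term x r) = 0"
proof -
  have nz: "r \<noteq> 0" if "r \<in># proots g" for r
    using that symmetric_poly_0_nonroot[OF assms(1,2)] assms(2) by auto
  have "(\<Sum>r\<in>#proots g. poisson_term x r) =
      (\<Sum>r\<in>#image_mset (\<lambda>r. inverse (cnj r)) (proots g). poisson_term x r)"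
    by (simp only: symmetric_poly_proots_invariant[OF assms(1)])
  also have "\<dots> = (\<Sum>r\<in>#proots g. - poisson_term x r)"
    unfolding multiset.map_comp o_def
    by (intro arg_cong[where f = sum_mset] image_mset_cong poisson_term_reflect nz assms(3))
  also have "\<dots> = - (\<Sum>r\<in>#proots g. poisson_term x r)"
    using sum_mset_distrib_left[of "-1" "poisson_term x" "proots g"] by simp
  finally show ?thesis by simp
qed

section \<open>Degree of \<open>f\<close> and sign of \<open>f / g\<close> just outside the
  circle\<close>

lemma degree_g_delta_minus_smult:
  assumes "Re z > 0"
  shows "degree (g_delta g - smult z g) = degree g"
proof (cases "g = 0")
  case False
  let ?f = "g_delta g - smult z g"
  have co: "coeff ?f k = (of_nat (degree g) / 2 - of_nat k - z) * coeff g k" for k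
    by (cases k) (simp_all add: g_delta_def coeff_pderiv algebra_simps)
  \<comment> \<open>This factor of the leading coefficient has real part
    \<open>- degree g / 2 - Re z\<close>, so the top term cannot cancel.\<close>
  have "Re (of_nat (degree g) / 2 - of_nat (degree g) - z) < 0"
    using assms by simp
  then have "coeff ?f (degree g) \<noteq> 0"
    using False unfolding co by (auto simp del: minus_complex.simps)
  moreover have "degree ?f \<le> degree g"
    by (rule degree_le) (simp add: co coeff_eq_0 del: coeff_diff)
  ultimately show ?thesis
    by (blast intro: antisym le_degree)
qed (simp add: g_delta_def)

text \<open>The bound is one-sided: terms of unimodular roots may blow up near the circle, but from
  outside they only push the real part down. The slack \<open>c\<close>, later \<open>Re z\<close>,
  absorbs the remaining continuous part \<open>F\<close>.\<close>

lemma Re_g_delta_quotient_less: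
  assumes "symmetric_poly g" "g \<noteq> 0" "0 < c"
  obtains e where "e > 0"
    "\<And>x. 1 < norm x \<Longrightarrow> norm x < 1 + e \<Longrightarrow>
      poly g x \<noteq> 0 \<and> Re (poly (g_delta g) x / poly g x) < c"
proof -
  define N where "N = {# r \<in># proots g. norm r \<noteq> 1 #}"
  define T where "T = {# r \<in># proots g. norm r = 1 #}"
  define F where "F = (\<lambda>x. \<Sum>r\<in>#N. poisson_term x r)"
  have split: "(\<Sum>r\<in>#proots g. poisson_term x r) = F x + (\<Sum>r\<in>#T. poisson_term x r)" for x
  proof -
    have "proots g = N + T"
      unfolding N_def T_def using multiset_partition[of "proots g" "\<lambda>r. norm r \<noteq> 1"] by simp
    then show ?thesis by (simp add: F_def)
  qed
  have "open (- set_mset N)"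
    by (simp add: finite_imp_closed open_Compl)
  moreover have "continuous_on (- set_mset N) F"
    unfolding F_def by (rule continuous_on_poisson_sum) auto
  ultimately have "open (- set_mset N \<inter> F -` {-c<..})"
    by (intro continuous_open_preimage) auto
  moreover have "sphere 0 1 \<subseteq> - set_mset N \<inter> F -` {-c<..}"
  proof
    fix x :: complex
    assume "x \<in> sphere 0 1"
    then have x: "norm x = 1" by simp
    have "(\<Sum>r\<in>#T. poisson_term x r) = 0"
      by (rule sum_mset.neutral) (auto simp: T_def poisson_term_def x)
    then have "F x = 0"
      using split[of x] poisson_sum_symmetric_eq_0[OF assms(1,2) x] by simp
    then show "x \<in> - set_mset N \<inter> F -` {-c<..}"
      using x \<open>0 < c\<close> by (auto simp: N_def)
  qed
  \<comment> \<open>Compactness of the circle makes the width \<open>e\<close> uniform.\<close>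
  ultimately obtain e where "e > 0"
    and e: "(\<Union>x\<in>sphere 0 1. ball x e) \<subseteq> - set_mset N \<inter> F -` {-c<..}"
    using compact_subset_open_imp_ball_epsilon_subset[OF compact_sphere] by metis
  show thesis
  proof (rule that[OF \<open>e > 0\<close>])
    fix x :: complex
    assume x: "1 < norm x" "norm x < 1 + e"
    \<comment> \<open>The radial projection \<open>sgn x\<close> is the point of the circle used to
      place \<open>x\<close> in the neighbourhood.\<close>
    have "dist (sgn x) x = norm (sgn x - of_real (norm x) * sgn x)"
      by (simp add: dist_norm sgn_eq)
    also have "\<dots> = norm (of_real (1 - norm x) * sgn x)"
      by (simp add: algebra_simps)
    also have "\<dots> = norm x - 1"
      unfolding norm_mult norm_of_real norm_sgn using x by auto
    finally have "x \<in> ball (sgn x) e" using x by simp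
    moreover have "sgn x \<in> sphere 0 1" using x by (auto simp: norm_sgn)
    ultimately have "x \<in> - set_mset N \<inter> F -` {-c<..}" using e by blast
    then have xN: "x \<notin># N" and Fx: "- c < F x" by auto
    \<comment> \<open>A root of norm greater than 1 would belong to \<open>N\<close>.\<close>
    have "poly g x \<noteq> 0" using xN x \<open>g \<noteq> 0\<close> by (auto simp: N_def)
    have "(\<Sum>r\<in>#T. 0) \<le> (\<Sum>r\<in>#T. poisson_term x r)"
    proof (rule sum_mset_mono)
      fix r assume "r \<in># T"
      then have "norm r = 1" by (simp add: T_def)
      then show "0 \<le> poisson_term x r"
        using x by (simp add: poisson_term_def)
    qed
    then have "Re (poly (g_delta g) x / poly g x) < c"
      using Fx unfolding Re_g_delta_quotient[OF \<open>poly g x \<noteq> 0\<close>] split by simp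
    with \<open>poly g x \<noteq> 0\<close> show "poly g x \<noteq> 0 \<and> Re (poly (g_delta g) x / poly g x) < c" ..
  qed
qed

section \<open>Comparison of the root counts\<close>

text \<open>With no roots in the annulus, those beyond the unit circle are exactly those not in the
  open disc of radius \<rho>, and all roots together number \<open>degree p\<close>.\<close>

lemma size_proots_outside:
  fixes p :: "complex poly"
  assumes "p \<noteq> 0" "1 < \<rho>" "\<And>x. 1 < norm x \<Longrightarrow> norm x \<le> \<rho> \<Longrightarrow> poly p x \<noteq> 0"
  shows "size {# r \<in># proots p. norm r > 1 #} + size {# r \<in># proots p. norm r < \<rho> #} = degree p"
proof -
  have "{# r \<in># proots p. norm r > 1 #} = {# r \<in># proots p. \<not> norm r < \<rho> #}"
    by (rule filter_mset_cong) (use assms in \<open>force simp: not_less\<close>)+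
  moreover have "proots p = {# r \<in># proots p. norm r < \<rho> #} + {# r \<in># proots p. \<not> norm r < \<rho> #}"
    by (rule multiset_partition)
  ultimately show ?thesis
    by (metis add.commute size_union size_proots_complex)
qed

theorem theorem3:
  fixes g f :: "complex poly" and z :: complex
  assumes "symmetric_poly g"
    and "degree g \<ge> 1"
    and "Re z > 0"
    and "f = g_delta g - smult z g"
  shows "size {# x \<in># proots f. norm x > 1 #} = size {# x \<in># proots g. norm x < 1 #} \<and>
    size {# x \<in># proots f. norm x > 1 #} = size {# x \<in># proots g. norm x > 1 #}"
proof -
  have "g \<noteq> 0" using assms(2) by auto
  have deg: "degree f = degree g"
    using degree_g_delta_minus_smult[OF assms(3)] assms(4) by simp
  then have "f \<noteq> 0" using assms(2) by auto
  obtain e where "e > 0" and e: "\<And>x. 1 < norm x \<Longrightarrow> norm x < 1 + e \<Longrightarrow>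
      poly g x \<noteq> 0 \<and> Re (poly (g_delta g) x / poly g x) < Re z"
    using Re_g_delta_quotient_less[OF assms(1) \<open>g \<noteq> 0\<close> assms(3)] by metis
  have neg: "poly g x \<noteq> 0" "Re (poly f x / poly g x) < 0" if "1 < norm x" "norm x < 1 + e" for x
  proof -
    show "poly g x \<noteq> 0" using e[OF that] by simp
    then have "poly f x / poly g x = poly (g_delta g) x / poly g x - z"
      unfolding assms(4) by (simp add: diff_divide_distrib)
    then show "Re (poly f x / poly g x) < 0" using e[OF that] by simp
  qed
  \<comment> \<open>Half of \<open>e\<close> keeps the circle of radius \<rho> itself inside the
    open annulus where the sign is known.\<close>
  define \<rho> where "\<rho> = 1 + e / 2"
  have \<rho>: "1 < \<rho>" "\<rho> < 1 + e" using \<open>e > 0\<close> by (auto simp: \<rho>_def)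
  have "size {# r \<in># proots f. norm r < \<rho> #} = size {# r \<in># proots g. norm r < \<rho> #}"
    by (rule size_proots_inside_eq) (use neg \<rho> in auto)
  moreover have "size {# r \<in># proots f. norm r > 1 #} + size {# r \<in># proots f. norm r < \<rho> #} = degree f"
    by (rule size_proots_outside) (use \<open>f \<noteq> 0\<close> neg \<rho> in force)+
  moreover have "size {# r \<in># proots g. norm r > 1 #} + size {# r \<in># proots g. norm r < \<rho> #} = degree g"
    by (rule size_proots_outside) (use \<open>g \<noteq> 0\<close> neg \<rho> in force)+
  ultimately have "size {# x \<in># proots f. norm x > 1 #} = size {# x \<in># proots g. norm x > 1 #}"
    using deg by simp
  then show ?thesis
    using symmetric_poly_size_inside_eq_outside[OF assms(1) \<open>g \<noteq> 0\<close>] by simp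
qed

end
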